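(* Let $r$ and $n$ be positive integers, let $(\mathcal E_r,* )$ be the Euler algebra of index $r$, and let $\epsilon=e^{2\pi\sqrt{-1}/r}$. Let $\rho_n:\mathcal E_r\to\mathbb C$ be the $\mathbb C$-linear map defined on words by $$\rho_n(z_{i_1,j_1}z_{i_2,j_2}\cdots z_{i_k,j_k})=A_{(i_1,\dots,i_k)}(n;\epsilon^{j_1},\dots,\epsilon^{j_k}).$$ Then $\rho_n$ is a homomorphism of algebras from $(\mathcal E_r,* )$ into $\mathbb C$.
   Context: For a sequence $I=(i_1,\dots,i_k)$ of positive integers, a positive integer $n$ and complex numbers $x_1,\dots,x_k$, the multiple harmonic sum is $$A_I(n;x_1,\dots,x_k)=\sum_{n\ge n_1>n_2>\cdots>n_k\ge 1}\frac{x_1^{n_1}x_2^{n_2}\cdots x_k^{n_k}}{n_1^{i_1}n_2^{i_2}\cdots n_k^{i_k}}.$$ For the empty sequence ($k=0$) the value is $1$. The Euler algebra of index $r$ ($r$ a positive integer): take noncommuting symbols (letters) $z_{i,j}$ with $i,j$ integers, $i\ge 1$ and $0\le j\le r-1$. $\mathcal E_r$ is the complex vector space with basis the set of all words (finite strings) in these letters, including the empty word, denoted $1$. The product $*$ on $\mathcal E_r$ is the $\mathbb C$-bilinear product defined recursively by $1*w=w*1=w$ for all words $w$, and $$z_{i,j}w_1*z_{m,n}w_2=z_{i,j}(w_1*z_{m,n}w_2)+z_{m,n}(z_{i,j}w_1*w_2)+z_{i+m,j+n}(w_1*w_2)$$ for all letters $z_{i,j},z_{m,n}$ and all words $w_1,w_2$,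 where juxtaposition is concatenation (extended linearly) and addition in the second subscript is modulo $r$. With this product $\mathcal E_r$ is a commutative associative unital $\mathbb C$-algebra with unit the empty word $1$. *)

theory Defs
  imports
    Complex_Main
    "HOL-Library.Poly_Mapping"
    "HOL-Algebra.Module"
    "HOL-Algebra.Algebraic_Closure_Type"
begin

section \<open>Multiple harmonic sums\<close>

text \<open>
  The index tuple \<open>(n\<^sub>1, \<dots>, n\<^sub>k)\<close> is a strictly decreasing list of length \<open>k = length I\<close> with
  entries in \<open>{1..n}\<close>. The list \<open>xs\<close> is meant to have the same length as \<open>I\<close>.
\<close>

definition harmonic_indices :: "nat \<Rightarrow> nat \<Rightarrow> nat list set" where
  "harmonic_indices k n = {N. length N = k \<and> sorted_wrt (>) N \<and> set N \<subseteq> {1..n}}"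

lemma finite_harmonic_indices: "finite (harmonic_indices k n)"
  by (rule finite_subset[OF _ finite_lists_length_eq[of "{1..n}" k]])
     (auto simp: harmonic_indices_def)

definition multiple_harmonic_sum :: "nat list \<Rightarrow> nat \<Rightarrow> complex list \<Rightarrow> complex" where
  "multiple_harmonic_sum I n xs =
     (\<Sum>N \<in> harmonic_indices (length I) n.
        \<Prod>l<length I. (xs ! l) ^ (N ! l) / of_nat (N ! l) ^ (I ! l))"

lemma multiple_harmonic_sum_Nil: "multiple_harmonic_sum [] n [] = 1"
proof -
  have "harmonic_indices 0 n = {[]}"
    by (auto simp: harmonic_indices_def)
  then show ?thesis
    by (simp add: multiple_harmonic_sum_def)
qed

section \<open>The Euler algebra of index r\<close>

text \<open>
  The pair \<open>(i, j)\<close> stands for the letter \<open>z\<^sub>i\<^sub>,\<^sub>j\<close>. Only the letters in \<open>letters r\<close> occur in the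
  carrier of the algebra. The vector space on all words is \<open>word \<Rightarrow>\<^sub>0 complex\<close>, in which
  \<open>Poly_Mapping.single w 1\<close> is the basis element \<open>w\<close>.
\<close>

type_synonym word = "(nat \<times> nat) list"

definition letters :: "nat \<Rightarrow> (nat \<times> nat) set" where
  "letters r = {1..} \<times> {..<r}"

definition scale :: "complex \<Rightarrow> ('v \<Rightarrow>\<^sub>0 complex) \<Rightarrow> ('v \<Rightarrow>\<^sub>0 complex)" where
  "scale c p = Poly_Mapping.map ((*) c) p"

definition linear_extension ::
    "('u \<Rightarrow> ('v \<Rightarrow>\<^sub>0 complex)) \<Rightarrow> ('u \<Rightarrow>\<^sub>0 complex) \<Rightarrow> ('v \<Rightarrow>\<^sub>0 complex)" where
  "linear_extension f p = (\<Sum>w \<in> Poly_Mapping.keys p. scale (Poly_Mapping.lookup p w) (f w))"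

definition prepend :: "nat \<times> nat \<Rightarrow> (word \<Rightarrow>\<^sub>0 complex) \<Rightarrow> (word \<Rightarrow>\<^sub>0 complex)" where
  "prepend a = linear_extension (\<lambda>w. Poly_Mapping.single (a # w) 1)"

fun word_product :: "nat \<Rightarrow> word \<Rightarrow> word \<Rightarrow> (word \<Rightarrow>\<^sub>0 complex)" where
  "word_product r [] w = Poly_Mapping.single w 1"
| "word_product r w [] = Poly_Mapping.single w 1"
| "word_product r ((i, j) # w1) ((m, n) # w2) =
     prepend (i, j) (word_product r w1 ((m, n) # w2)) +
     prepend (m, n) (word_product r ((i, j) # w1) w2) +
     prepend (i + m, (j + n) mod r) (word_product r w1 w2)"

definition euler_product ::
    "nat \<Rightarrow> (word \<Rightarrow>\<^sub>0 complex) \<Rightarrow> (word \<Rightarrow>\<^sub>0 complex) \<Rightarrow> (word \<Rightarrow>\<^sub>0 complex)" where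
  "euler_product r p q = linear_extension (\<lambda>u. linear_extension (\<lambda>v. word_product r u v) q) p"

definition euler_algebra :: "nat \<Rightarrow> (complex, word \<Rightarrow>\<^sub>0 complex) module" where
  "euler_algebra r = \<lparr>
     carrier = {p. Poly_Mapping.keys p \<subseteq> lists (letters r)},
     monoid.mult = euler_product r,
     one = Poly_Mapping.single [] 1,
     ring.zero = 0,
     add = (+),
     module.smult = scale \<rparr>"

section \<open>Homomorphisms of algebras\<close>

text \<open>\<open>\<complex>\<close> as an algebra over itself; its underlying ring is \<open>ring_of_type_algebra\<close>.\<close>

definition complex_algebra :: "(complex, complex) module" where
  "complex_algebra = ring.extend ring_of_type_algebra \<lparr> module.smult = (*) \<rparr>"

text \<open>Additivity, multiplicativity and preservation of the unit are part of \<open>ring_hom\<close>.\<close>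

definition algebra_hom ::
    "'k ring \<Rightarrow> ('k, 'a) module \<Rightarrow> ('k, 'b) module \<Rightarrow> ('a \<Rightarrow> 'b) set" where
  "algebra_hom K A B =
     {h \<in> ring_hom A B.
        \<forall>c \<in> carrier K. \<forall>x \<in> carrier A. h (c \<odot>\<^bsub>A\<^esub> x) = c \<odot>\<^bsub>B\<^esub> h x}"

section \<open>The map given by multiple harmonic sums\<close>

definition root_eps :: "nat \<Rightarrow> complex" where
  "root_eps r = exp (2 * of_real pi * \<i> / of_nat r)"

definition rho_word :: "nat \<Rightarrow> nat \<Rightarrow> word \<Rightarrow> complex" where
  "rho_word r n w = multiple_harmonic_sum (map fst w) n (map (\<lambda>(i, j). root_eps r ^ j) w)"

definition rho :: "nat \<Rightarrow> nat \<Rightarrow> (word \<Rightarrow>\<^sub>0 complex) \<Rightarrow> complex" where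
  "rho r n p = (\<Sum>w \<in> Poly_Mapping.keys p. Poly_Mapping.lookup p w * rho_word r n w)"

end

theory Submission
  imports Defs
begin

text \<open>
  Splitting a multiple harmonic sum according to whether its largest index reaches the upper
  bound gives
  \<open>\<rho>\<^sub>n\<^sub>+\<^sub>1 (a w) = \<rho>\<^sub>n (a w) + t\<^sub>a (n+1) \<cdot> \<rho>\<^sub>n (w)\<close>,
  where \<open>t\<^sub>a (m) = \<epsilon>\<^sup>j\<^sup>m / m\<^sup>i\<close> for the letter \<open>a = z\<^sub>i\<^sub>,\<^sub>j\<close>
  (lemma \<open>rho_word_Cons_Suc\<close>, extended linearly in \<open>rho_prepend_Suc\<close>).
  The weights satisfy \<open>t\<^sub>a t\<^sub>b = t\<^sub>c\<close> for the letter \<open>c\<close> obtained by merging \<open>a\<close> and \<open>b\<close>,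
  because \<open>\<epsilon>\<close> is an \<open>r\<close>-th root of unity, so that adding second subscripts modulo \<open>r\<close> is
  harmless (\<open>weight_merge\<close>).

  Multiplicativity on words then follows by induction on the upper bound \<open>n\<close>, simultaneously for
  all pairs of words. For letters \<open>a\<close>, \<open>b\<close> and with the weights taken at \<open>n+1\<close>, expanding
  \<open>(\<rho>\<^sub>n (au) + t\<^sub>a \<cdot> \<rho>\<^sub>n (u)) \<cdot> (\<rho>\<^sub>n (bv) + t\<^sub>b \<cdot> \<rho>\<^sub>n (v))\<close>
  gives four terms. The first is \<open>\<rho>\<^sub>n\<close> of the whole product \<open>au * bv\<close>, and the other three come
  from the three summands in the recursive definition of \<open>au * bv\<close>: the new largest index
  \<open>n+1\<close> is used by the first factor only, by the second factor only, or by both. Bilinearity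
  passes from words to the whole algebra.
\<close>

section \<open>Linear functionals on formal combinations\<close>

text \<open>
  The scalar-valued counterpart of \<open>linear_extension\<close>; the map \<open>rho\<close> is an instance of it.
\<close>

definition linear_functional :: "('v \<Rightarrow> complex) \<Rightarrow> ('v \<Rightarrow>\<^sub>0 complex) \<Rightarrow> complex" where
  "linear_functional f p = (\<Sum>w \<in> Poly_Mapping.keys p. Poly_Mapping.lookup p w * f w)"

lemma rho_eq_linear_functional: "rho r n = linear_functional (rho_word r n)"
  by (simp add: fun_eq_iff rho_def linear_functional_def)

text \<open>
  Combinations with different supports can be compared once the sums run over a common finite set.
\<close>

lemma linear_functional_superset:
  assumes "finite A" "Poly_Mapping.keys p \<subseteq> A"
  shows "linear_functional f p = (\<Sum>w \<in> A. Poly_Mapping.lookup p w * f w)"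
  unfolding linear_functional_def
  by (rule sum.mono_neutral_left) (use assms in \<open>auto simp: in_keys_iff\<close>)

lemma linear_functional_zero [simp]: "linear_functional f 0 = 0"
  by (simp add: linear_functional_def)

lemma linear_functional_single [simp]: "linear_functional f (Poly_Mapping.single w c) = c * f w"
  by (simp add: linear_functional_def)

lemma linear_functional_add:
  "linear_functional f (p + q) = linear_functional f p + linear_functional f q"
proof -
  let ?A = "Poly_Mapping.keys p \<union> Poly_Mapping.keys q"
  have "linear_functional f (p + q) = (\<Sum>w \<in> ?A. Poly_Mapping.lookup (p + q) w * f w)"
    by (rule linear_functional_superset) (use Poly_Mapping.keys_add[of p q] in auto)
  also have "\<dots> = (\<Sum>w \<in> ?A. Poly_Mapping.lookup p w * f w) +
      (\<Sum>w \<in> ?A. Poly_Mapping.lookup q w * f w)"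
    by (simp add: lookup_add distrib_right sum.distrib)
  also have "\<dots> = linear_functional f p + linear_functional f q"
    by (simp add: linear_functional_superset[of ?A])
  finally show ?thesis .
qed

lemma lookup_scale: "Poly_Mapping.lookup (scale c p) w = c * Poly_Mapping.lookup p w"
  by (simp add: scale_def Poly_Mapping.map.rep_eq when_def)

lemma linear_functional_scale: "linear_functional f (scale c p) = c * linear_functional f p"
proof -
  have "linear_functional f (scale c p) =
      (\<Sum>w \<in> Poly_Mapping.keys p. Poly_Mapping.lookup (scale c p) w * f w)"
    by (rule linear_functional_superset) (auto simp: in_keys_iff lookup_scale)
  then show ?thesis
    by (simp add: lookup_scale linear_functional_def sum_distrib_left mult.assoc)
qed

lemma linear_functional_sum:
  "linear_functional f (\<Sum>x \<in> A. g x) = (\<Sum>x \<in> A. linear_functional f (g x))"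
  by (induction A rule: infinite_finite_induct) (simp_all add: linear_functional_add)

lemma linear_functional_linear_extension:
  "linear_functional f (linear_extension g p) = linear_functional (\<lambda>u. linear_functional f (g u)) p"
  by (simp add: linear_extension_def linear_functional_sum linear_functional_scale)
     (simp add: linear_functional_def)

lemma linear_functional_cmult:
  "linear_functional (\<lambda>u. c * f u) p = c * linear_functional f p"
  by (simp add: linear_functional_def sum_distrib_left mult.left_commute)

lemma linear_functional_fun_add:
  "linear_functional (\<lambda>u. f u + g u) p = linear_functional f p + linear_functional g p"
  by (simp add: linear_functional_def sum.distrib distrib_left)

section \<open>Recursion of multiple harmonic sums in the upper bound\<close>

lemma harmonic_indices_Suc_0: "harmonic_indices (Suc k) 0 = {}"
  by (auto simp: harmonic_indices_def)

text \<open>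
  A strictly decreasing tuple bounded by \<open>n + 1\<close> can contain \<open>n + 1\<close> only in first position.
\<close>

lemma harmonic_indices_Suc_Suc:
  "harmonic_indices (Suc k) (Suc n) =
     harmonic_indices (Suc k) n \<union> (#) (Suc n) ` harmonic_indices k n"
proof (intro equalityI subsetI)
  fix N assume "N \<in> harmonic_indices (Suc k) (Suc n)"
  then obtain m M where N: "N = m # M" "length M = k" "sorted_wrt (>) M"
      "\<forall>x \<in> set M. x < m" "1 \<le> m" "m \<le> Suc n" "\<forall>x \<in> set M. 1 \<le> x"
    by (cases N) (auto simp: harmonic_indices_def subset_iff)
  then show "N \<in> harmonic_indices (Suc k) n \<union> (#) (Suc n) ` harmonic_indices k n"
    by (cases "m = Suc n") (fastforce simp: harmonic_indices_def)+
qed (fastforce simp: harmonic_indices_def)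

lemma multiple_harmonic_sum_Cons_0: "multiple_harmonic_sum (i # I) 0 (x # xs) = 0"
  by (simp add: multiple_harmonic_sum_def harmonic_indices_Suc_0)

lemma multiple_harmonic_sum_Cons_Suc:
  "multiple_harmonic_sum (i # I) (Suc n) (x # xs) =
     multiple_harmonic_sum (i # I) n (x # xs) +
     x ^ Suc n / of_nat (Suc n) ^ i * multiple_harmonic_sum I n xs"
proof -
  let ?k = "length I"
  let ?F = "\<lambda>N. \<Prod>l<Suc ?k. ((x # xs) ! l) ^ (N ! l) / (of_nat (N ! l) :: complex) ^ ((i # I) ! l)"
  have disj: "harmonic_indices (Suc ?k) n \<inter> (#) (Suc n) ` harmonic_indices ?k n = {}"
    by (auto simp: harmonic_indices_def)
  have "multiple_harmonic_sum (i # I) (Suc n) (x # xs) =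
      sum ?F (harmonic_indices (Suc ?k) n) + sum ?F ((#) (Suc n) ` harmonic_indices ?k n)"
    unfolding multiple_harmonic_sum_def list.size(4) add_Suc_right add_0_right
      harmonic_indices_Suc_Suc
    by (rule sum.union_disjoint) (use disj in \<open>simp_all add: finite_harmonic_indices\<close>)
  also have "sum ?F (harmonic_indices (Suc ?k) n) = multiple_harmonic_sum (i # I) n (x # xs)"
    by (simp add: multiple_harmonic_sum_def)
  also have "sum ?F ((#) (Suc n) ` harmonic_indices ?k n) =
      (\<Sum>N \<in> harmonic_indices ?k n. ?F (Suc n # N))"
    by (simp add: sum.reindex)
  also have "\<dots> = x ^ Suc n / of_nat (Suc n) ^ i * multiple_harmonic_sum I n xs"
    by (simp add: multiple_harmonic_sum_def prod.lessThan_Suc_shift sum_distrib_left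
        del: prod.lessThan_Suc power_Suc of_nat_Suc)
  finally show ?thesis .
qed

section \<open>Weights of letters\<close>

definition weight :: "nat \<Rightarrow> nat \<Rightarrow> nat \<times> nat \<Rightarrow> complex" where
  "weight r m a = (root_eps r ^ snd a) ^ m / of_nat m ^ fst a"

lemma root_eps_power_index:
  assumes "r \<ge> 1"
  shows "root_eps r ^ r = 1"
proof -
  have "root_eps r ^ r = exp (of_nat r * (2 * of_real pi * \<i> / of_nat r))"
    by (simp only: root_eps_def exp_of_nat_mult)
  also have "\<dots> = exp (2 * of_real pi * \<i>)"
    using assms by simp
  also have "\<dots> = 1"
    by (rule exp_two_pi_i)
  finally show ?thesis .
qed

lemma root_eps_power_mod:
  assumes "r \<ge> 1"
  shows "root_eps r ^ (j mod r) = root_eps r ^ j"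
proof -
  have "root_eps r ^ j = root_eps r ^ (r * (j div r) + j mod r)"
    by simp
  also have "\<dots> = root_eps r ^ (j mod r)"
    unfolding power_add power_mult root_eps_power_index[OF assms] by simp
  finally show ?thesis by simp
qed

lemma weight_merge:
  assumes "r \<ge> 1"
  shows "weight r k (i + m, (j + l) mod r) = weight r k (i, j) * weight r k (m, l)"
  by (simp add: weight_def root_eps_power_mod[OF assms] power_add power_mult_distrib)

section \<open>The map on words and on the whole algebra\<close>

lemma rho_word_Nil [simp]: "rho_word r n [] = 1"
  by (simp add: rho_word_def multiple_harmonic_sum_Nil)

lemma rho_word_Cons_0: "rho_word r 0 (a # w) = 0"
  by (simp add: rho_word_def multiple_harmonic_sum_Cons_0)

lemma rho_word_Cons_Suc:
  "rho_word r (Suc n) (a # w) = rho_word r n (a # w) + weight r (Suc n) a * rho_word r n w"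
  by (simp add: rho_word_def multiple_harmonic_sum_Cons_Suc weight_def case_prod_beta
      del: power_Suc of_nat_Suc)

lemma rho_prepend: "rho r n (prepend a p) = linear_functional (\<lambda>w. rho_word r n (a # w)) p"
  by (simp add: rho_eq_linear_functional prepend_def linear_functional_linear_extension)

lemma rho_prepend_0: "rho r 0 (prepend a p) = 0"
  by (simp add: rho_prepend rho_word_Cons_0 linear_functional_def)

lemma rho_prepend_Suc:
  "rho r (Suc n) (prepend a p) = rho r n (prepend a p) + weight r (Suc n) a * rho r n p"
  by (simp add: rho_prepend rho_word_Cons_Suc linear_functional_fun_add linear_functional_cmult)
     (simp add: rho_eq_linear_functional)

lemma rho_add: "rho r n (p + q) = rho r n p + rho r n q"
  by (simp add: rho_eq_linear_functional linear_functional_add)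

lemma rho_single [simp]: "rho r n (Poly_Mapping.single w c) = c * rho_word r n w"
  by (simp add: rho_eq_linear_functional)

lemma word_product_Nil_right: "word_product r w [] = Poly_Mapping.single w 1"
  by (cases w) simp_all

text \<open>
  The words are generalized in the induction on the upper bound because \<open>rho_prepend_Suc\<close> reduces
  the bound \<open>n + 1\<close> to \<open>n\<close> for four different products of words. At bound \<open>0\<close> the map
  is the projection onto the coefficient of the empty word, which is multiplicative.
\<close>

lemma rho_word_product:
  assumes "r \<ge> 1"
  shows "rho r n (word_product r u v) = rho_word r n u * rho_word r n v"
proof (induction n arbitrary: u v)
  case 0
  show ?case
    by (cases "(r, u, v)" rule: word_product.cases)
       (simp_all add: rho_add rho_prepend_0 rho_word_Cons_0)
next
  case (Suc n)
  show ?case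
  proof (cases "u = [] \<or> v = []")
    case True
    then show ?thesis
      by (auto simp: word_product_Nil_right)
  next
    case False
    then obtain i j u' m l v' where uv: "u = (i, j) # u'" "v = (m, l) # v'"
      by (metis list.exhaust surj_pair)
    let ?s = "weight r (Suc n) (i, j)" and ?t = "weight r (Suc n) (m, l)"
    have "rho r (Suc n) (word_product r u v) = rho r n (word_product r u v) +
        ?s * rho r n (word_product r u' v) + ?t * rho r n (word_product r u v') +
        ?s * ?t * rho r n (word_product r u' v')"
      by (simp add: uv rho_add rho_prepend_Suc weight_merge[OF assms])
    also have "\<dots> = (rho_word r n u + ?s * rho_word r n u') * (rho_word r n v + ?t * rho_word r n v')"
      unfolding Suc.IH by (simp add: algebra_simps)
    also have "\<dots> = rho_word r (Suc n) u * rho_word r (Suc n) v"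
      by (simp add: uv rho_word_Cons_Suc)
    finally show ?thesis .
  qed
qed

lemma rho_euler_product:
  assumes "r \<ge> 1"
  shows "rho r n (euler_product r p q) = rho r n p * rho r n q"
proof -
  have "rho r n (euler_product r p q) =
      linear_functional (\<lambda>u. linear_functional (\<lambda>v. rho r n (word_product r u v)) q) p"
    by (simp add: rho_eq_linear_functional euler_product_def linear_functional_linear_extension)
  also have "\<dots> = linear_functional (\<lambda>u. rho_word r n u * rho r n q) p"
    by (simp only: rho_word_product[OF assms] linear_functional_cmult)
       (simp only: rho_eq_linear_functional)
  also have "\<dots> = linear_functional (\<lambda>u. rho r n q * rho_word r n u) p"
    by (simp only: mult.commute)
  also have "\<dots> = rho r n p * rho r n q"
    unfolding linear_functional_cmult by (simp add: rho_eq_linear_functional)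
  finally show ?thesis .
qed

theorem theorem3p1:
  fixes r n :: nat
  assumes "r \<ge> 1" and "n \<ge> 1"
  shows "rho r n \<in> algebra_hom ring_of_type_algebra (euler_algebra r) complex_algebra"
proof -
  have "rho r n (scale c p) = c * rho r n p" for c p
    by (simp add: rho_eq_linear_functional linear_functional_scale)
  then show ?thesis
    by (auto simp: algebra_hom_def ring_hom_def euler_algebra_def complex_algebra_def
        ring.extend_def ring_of_type_algebra_def rho_euler_product[OF assms(1)] rho_add)
qed

end
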